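(* Let $n,r$ be positive integers. The semifield of $S_n$-invariant tropical rational functions on $\mathbb{R}^{n\times r}$ is generated by $\binom{n+r}{r}-1$ elements of degree at most $n$ (each of them an $S_n$-invariant tropical polynomial).
   Context: The symmetric group $S_n$ acts on $\mathbb{R}^{n\times r}$ ($n\times r$ real matrices) by permuting rows. A tropical polynomial on $\mathbb{R}^m$ is a finite maximum $\max_j \ell_j$ of functions $\ell_j(z)=\gamma_j+\langle a_j,z\rangle$ with $\gamma_j\in\mathbb{R}$, $a_j\in\mathbb{Z}_{\ge0}^m$; its degree is the smallest value, over all such representations of the function, of $\max_j\|a_j\|_1$. A tropical rational function on $\mathbb{R}^m$ is a difference of two tropical polynomials, regarded as a function $\mathbb{R}^m\to\mathbb{R}$. These functions form a semifield under $\max$ (addition), $+$ (multiplication), $-$ (division). Invariant functions $f_1,\dots,f_k$ generate the semifield of invariant tropical rational functions if every invariant tropical rational $f$ equals $g(f_1,\dots,f_k)$ for some tropical rational $g$ on $\mathbb{R}^k$. *)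

theory Defs
  imports Complex_Main "HOL-Combinatorics.Permutations"
begin

text \<open>
  For a finite index set \<open>I\<close>, a function on \<open>\<real>\<^sup>I\<close> is represented by a function on all families
  \<open>z :: 'i \<Rightarrow> real\<close> which depends only on the coordinates in \<open>I\<close>; for tropical functions this
  dependence is automatic, see \<open>trop_rational_cong\<close> below. Hence equality in the type
  \<open>('i \<Rightarrow> real) \<Rightarrow> real\<close> of two tropical functions on \<open>\<real>\<^sup>I\<close> is equality as functions on \<open>\<real>\<^sup>I\<close>.
\<close>

text \<open>A pair \<open>(c, a) \<in> T\<close> encodes the affine form \<open>z \<mapsto> c + \<langle>a, z\<rangle>\<close> on \<open>\<real>\<^sup>I\<close>.\<close>

definition trop_repr ::
    "'i set \<Rightarrow> (real \<times> ('i \<Rightarrow> nat)) set \<Rightarrow> (('i \<Rightarrow> real) \<Rightarrow> real) \<Rightarrow> bool" where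
  "trop_repr I T f \<longleftrightarrow> finite T \<and> T \<noteq> {} \<and>
     (\<forall>z. f z = Max ((\<lambda>(c, a). c + (\<Sum>i\<in>I. real (a i) * z i)) ` T))"

definition trop_polynomial :: "'i set \<Rightarrow> (('i \<Rightarrow> real) \<Rightarrow> real) \<Rightarrow> bool" where
  "trop_polynomial I f \<longleftrightarrow> (\<exists>T. trop_repr I T f)"

definition trop_degree :: "'i set \<Rightarrow> (('i \<Rightarrow> real) \<Rightarrow> real) \<Rightarrow> nat" where
  "trop_degree I f = (LEAST d. \<exists>T. trop_repr I T f \<and> d = Max ((\<lambda>(c, a). \<Sum>i\<in>I. a i) ` T))"

definition trop_rational :: "'i set \<Rightarrow> (('i \<Rightarrow> real) \<Rightarrow> real) \<Rightarrow> bool" where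
  "trop_rational I f \<longleftrightarrow>
     (\<exists>p q. trop_polynomial I p \<and> trop_polynomial I q \<and> f = (\<lambda>z. p z - q z))"

lemma trop_polynomial_cong:
  assumes "trop_polynomial I f" and "\<And>i. i \<in> I \<Longrightarrow> z i = w i"
  shows "f z = f w"
proof -
  have "(\<Sum>i\<in>I. real (a i) * z i) = (\<Sum>i\<in>I. real (a i) * w i)" for a
    using assms(2) by (intro sum.cong) auto
  then show ?thesis
    using assms(1) by (auto simp: trop_polynomial_def trop_repr_def)
qed

lemma trop_rational_cong:
  assumes "trop_rational I f" and "\<And>i. i \<in> I \<Longrightarrow> z i = w i"
  shows "f z = f w"
  using assms trop_polynomial_cong unfolding trop_rational_def by metis

text \<open>An \<open>n \<times> r\<close> matrix is a family indexed by \<open>{..<n} \<times> {..<r}\<close> (row, column).\<close>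

definition mat_index :: "nat \<Rightarrow> nat \<Rightarrow> (nat \<times> nat) set" where
  "mat_index n r = {..<n} \<times> {..<r}"

definition row_invariant :: "nat \<Rightarrow> ((nat \<times> nat \<Rightarrow> real) \<Rightarrow> real) \<Rightarrow> bool" where
  "row_invariant n f \<longleftrightarrow>
     (\<forall>\<pi>. \<pi> permutes {..<n} \<longrightarrow> (\<forall>z. f (\<lambda>(i, j). z (\<pi> i, j)) = f z))"

definition inv_trop_rational :: "nat \<Rightarrow> nat \<Rightarrow> ((nat \<times> nat \<Rightarrow> real) \<Rightarrow> real) set" where
  "inv_trop_rational n r = {f. trop_rational (mat_index n r) f \<and> row_invariant n f}"

text \<open>The family \<open>h 0, \<dots>, h (k - 1)\<close> generates \<open>F\<close>; the values \<open>h j\<close> with \<open>j \<ge> k\<close> are irrelevant.\<close>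

definition trop_generates ::
    "nat \<Rightarrow> (nat \<Rightarrow> ('i \<Rightarrow> real) \<Rightarrow> real) \<Rightarrow> (('i \<Rightarrow> real) \<Rightarrow> real) set \<Rightarrow> bool" where
  "trop_generates k h F \<longleftrightarrow>
     (\<forall>j<k. h j \<in> F) \<and>
     (\<forall>f\<in>F. \<exists>g. trop_rational {..<k} g \<and> f = (\<lambda>z. g (\<lambda>j. h j z)))"

end

theory Submission
  imports Defs "HOL-Combinatorics.Multiset_Permutations"
begin

text \<open>
  Append to every row \<open>z\<^sub>i\<close> of the matrix a null column, indexed by \<open>r\<close>, with entry \<open>0\<close>. For a multiset
  \<open>\<alpha>\<close> of \<open>n\<close> columns from \<open>{..r}\<close> the elementary function \<open>e\<^sub>\<alpha>(z)\<close> is the largest value of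
  \<open>\<Sum>\<^sub>i z\<^sub>i\<^sub>b\<^sub>(\<^sub>i\<^sub>)\<close> over all ways \<open>b\<close> of assigning the columns in \<open>\<alpha>\<close> to the rows. These are the tropical
  polarised elementary symmetric polynomials: invariant tropical polynomials of degree at most \<open>n\<close>.
  There are \<open>(n + r) choose r\<close> multisets, and the one that consists of null columns only gives \<open>0\<close>; the
  others are the generators.

  Two facts about the map \<open>z \<mapsto> e(z)\<close> give generation.

  It has finitely many candidate inverses, each of them integer linear (\<open>entry_from_elem_trop\<close>).
  Compare the other rows with row \<open>i\<close>: if \<open>\<beta>\<close> collects, for each row \<open>k \<noteq> i\<close>, a column that maximises
  \<open>z\<^sub>k - z\<^sub>i\<close>, then \<open>z\<^sub>i\<^sub>j\<close> is the difference of two elementary functions, those of \<open>\<beta>\<close> with the column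
  \<open>j\<close> added and of \<open>\<beta>\<close> with the null column added. Only the choice of the multisets \<open>\<beta>\<close>, one per row,
  depends on \<open>z\<close>.

  Modulo row permutations its inverse is Lipschitz (\<open>matching_exists\<close>, \<open>invariant_lipschitz\<close>). The functions
  \<open>e\<^sub>\<alpha>\<close> are the coefficients of the tropical polynomial \<open>t \<mapsto> \<Sum>\<^sub>i max\<^sub>j (z\<^sub>i\<^sub>j + t\<^sub>j)\<close>. An alternating sum of
  \<open>2\<^sup>r\<^sup>+\<^sup>1\<close> of its values equals, up to sign, \<open>\<Sum>\<^sub>i max 0 (c - osc(z\<^sub>i - y))\<close>, where \<open>osc\<close> is the difference
  between the largest and the smallest coordinate (\<open>alternating_row_energy\<close>). This sum
  of bumps detects the rows near \<open>y\<close>. Hence, if \<open>e(z)\<close> and \<open>e(w)\<close> are close, then every row of \<open>z\<close> has a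
  row of \<open>w\<close> close to it; remove such a pair and repeat.

  Let \<open>f\<close> be an invariant tropical rational function. By the second fact,
  \<open>\<bar>f(z) - f(w)\<bar> \<le> N \<Sum>\<^sub>\<alpha> \<bar>e\<^sub>\<alpha>(z) - e\<^sub>\<alpha>(w)\<bar>\<close> for some natural number \<open>N\<close>. With the candidate inverses \<open>L\<^sub>\<tau>\<close>
  put
  \<open>g(w) = max\<^sub>\<tau> (f(L\<^sub>\<tau> w) - N \<Sum>\<^sub>\<alpha> \<bar>e\<^sub>\<alpha>(L\<^sub>\<tau> w) - w\<^sub>\<alpha>\<bar>)\<close>,
  which is tropical rational. At \<open>w = e(z)\<close> no term exceeds \<open>f(z)\<close>, and a correct candidate attains it.
\<close>

section \<open>The semifield of tropical rational functions\<close>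

text \<open>
  Being the largest and being attained are easier to verify separately than an equation with
  \<open>Max\<close>, in particular for sums of two tropical polynomials.
\<close>

lemma trop_repr_iff:
  "trop_repr I T f \<longleftrightarrow> finite T \<and> T \<noteq> {} \<and>
     (\<forall>z. (\<forall>(c, a) \<in> T. c + (\<Sum>i\<in>I. real (a i) * z i) \<le> f z) \<and>
          (\<exists>(c, a) \<in> T. f z = c + (\<Sum>i\<in>I. real (a i) * z i)))"
  unfolding trop_repr_def
  by (rule conj_cong[OF refl], rule conj_cong[OF refl], rule all_cong1,
      subst eq_Max_iff) (auto simp: Ball_def Bex_def image_iff)

lemma trop_polynomial_add:
  assumes "trop_polynomial I f" "trop_polynomial I g"
  shows "trop_polynomial I (\<lambda>z. f z + g z)"
proof -
  obtain S T where S: "trop_repr I S f" and T: "trop_repr I T g"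
    using assms by (auto simp: trop_polynomial_def)
  have "trop_repr I ((\<lambda>((c, a), (d, b)). (c + d, \<lambda>i. a i + b i)) ` (S \<times> T)) (\<lambda>z. f z + g z)"
    unfolding trop_repr_iff
  proof (intro conjI allI)
    fix z
    let ?s = "\<lambda>a. \<Sum>i\<in>I. real (a i) * z i"
    have add: "?s (\<lambda>i. a i + b i) = ?s a + ?s b" for a b :: "'a \<Rightarrow> nat"
      by (simp add: sum.distrib distrib_right)
    have S': "\<And>c a. (c, a) \<in> S \<Longrightarrow> c + ?s a \<le> f z" "\<exists>c a. (c, a) \<in> S \<and> f z = c + ?s a"
      using S unfolding trop_repr_iff by fast+
    have T': "\<And>c a. (c, a) \<in> T \<Longrightarrow> c + ?s a \<le> g z" "\<exists>c a. (c, a) \<in> T \<and> g z = c + ?s a"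
      using T unfolding trop_repr_iff by fast+
    show "\<forall>(c, a)\<in>(\<lambda>((c, a), (d, b)). (c + d, \<lambda>i. a i + b i)) ` (S \<times> T).
        c + ?s a \<le> f z + g z"
    proof safe
      fix c a d b assume "(c, a) \<in> S" "(d, b) \<in> T"
      then show "c + d + ?s (\<lambda>i. a i + b i) \<le> f z + g z"
        unfolding add using S'(1)[of c a] T'(1)[of d b] by linarith
    qed
    obtain c a d b where ca: "(c, a) \<in> S" "f z = c + ?s a" and db: "(d, b) \<in> T" "g z = d + ?s b"
      using S'(2) T'(2) by blast
    show "\<exists>(c, a)\<in>(\<lambda>((c, a), (d, b)). (c + d, \<lambda>i. a i + b i)) ` (S \<times> T).
        f z + g z = c + ?s a"
    proof (rule bexI[of _ "(c + d, \<lambda>i. a i + b i)"])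
      show "case (c + d, \<lambda>i. a i + b i) of (c, a) \<Rightarrow> f z + g z = c + ?s a"
        unfolding prod.case add ca(2) db(2) by linarith
      show "(c + d, \<lambda>i. a i + b i) \<in> (\<lambda>((c, a), (d, b)). (c + d, \<lambda>i. a i + b i)) ` (S \<times> T)"
        using ca(1) db(1) by (intro image_eqI[where x = "((c, a), (d, b))"]) auto
    qed
  qed (use S T in \<open>auto simp: trop_repr_def\<close>)
  then show ?thesis by (auto simp: trop_polynomial_def)
qed

lemma trop_polynomial_max:
  assumes "trop_polynomial I f" "trop_polynomial I g"
  shows "trop_polynomial I (\<lambda>z. max (f z) (g z))"
proof -
  obtain S T where S: "trop_repr I S f" and T: "trop_repr I T g"
    using assms by (auto simp: trop_polynomial_def)
  have "trop_repr I (S \<union> T) (\<lambda>z. max (f z) (g z))"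
    using S T by (simp add: trop_repr_def image_Un Max_Un)
  then show ?thesis by (auto simp: trop_polynomial_def)
qed

lemma trop_polynomial_const: "trop_polynomial I (\<lambda>_. c)"
  unfolding trop_polynomial_def by (rule exI[of _ "{(c, \<lambda>_. 0)}"]) (simp add: trop_repr_def)

lemma trop_polynomial_coordinate:
  assumes "finite I" "i \<in> I"
  shows "trop_polynomial I (\<lambda>z. z i)"
  unfolding trop_polynomial_def
  using assms by (intro exI[of _ "{(0, \<lambda>k. if k = i then 1 else 0)}"])
    (simp add: trop_repr_def if_distrib[of real] if_distrib[of "\<lambda>x. x * _"] cong: if_cong)

lemma trop_rational_of_polynomial: "trop_polynomial I f \<Longrightarrow> trop_rational I f"
  unfolding trop_rational_def using trop_polynomial_const[of I 0] by force

lemma trop_rational_const: "trop_rational I (\<lambda>_. c)"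
  by (rule trop_rational_of_polynomial[OF trop_polynomial_const])

lemma trop_rational_diff:
  assumes "trop_rational I f" "trop_rational I g"
  shows "trop_rational I (\<lambda>z. f z - g z)"
proof -
  obtain p q p' q' where
    "trop_polynomial I p" "trop_polynomial I q" "f = (\<lambda>z. p z - q z)"
    "trop_polynomial I p'" "trop_polynomial I q'" "g = (\<lambda>z. p' z - q' z)"
    using assms unfolding trop_rational_def by blast
  moreover have "(\<lambda>z. f z - g z) = (\<lambda>z. (p z + q' z) - (q z + p' z))"
    using calculation by auto
  moreover have "trop_polynomial I (\<lambda>z. p z + q' z)" "trop_polynomial I (\<lambda>z. q z + p' z)"
    using calculation by (auto intro: trop_polynomial_add)
  ultimately show ?thesis
    unfolding trop_rational_def by blast
qed

lemma trop_rational_add: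
  assumes "trop_rational I f" "trop_rational I g"
  shows "trop_rational I (\<lambda>z. f z + g z)"
  using trop_rational_diff[OF assms(1) trop_rational_diff[OF trop_rational_const[of _ 0] assms(2)]]
  by simp

lemma trop_rational_max:
  assumes "trop_rational I f" "trop_rational I g"
  shows "trop_rational I (\<lambda>z. max (f z) (g z))"
proof -
  obtain p q p' q' where *:
    "trop_polynomial I p" "trop_polynomial I q" "f = (\<lambda>z. p z - q z)"
    "trop_polynomial I p'" "trop_polynomial I q'" "g = (\<lambda>z. p' z - q' z)"
    using assms unfolding trop_rational_def by blast
  have "(\<lambda>z. max (f z) (g z)) = (\<lambda>z. max (p z + q' z) (p' z + q z) - (q z + q' z))"
    using * by (auto simp: max_def)
  moreover have "trop_polynomial I (\<lambda>z. max (p z + q' z) (p' z + q z))"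
    using * by (intro trop_polynomial_max trop_polynomial_add)
  moreover have "trop_polynomial I (\<lambda>z. q z + q' z)"
    using * by (intro trop_polynomial_add)
  ultimately show ?thesis
    unfolding trop_rational_def by blast
qed

lemma trop_rational_abs:
  assumes "trop_rational I f"
  shows "trop_rational I (\<lambda>z. \<bar>f z\<bar>)"
proof -
  have "(\<lambda>z. \<bar>f z\<bar>) = (\<lambda>z. max (f z) (0 - f z))" by (auto simp: max_def)
  then show ?thesis
    using trop_rational_max[OF assms trop_rational_diff[OF trop_rational_const[of _ 0] assms]]
    by simp
qed

lemma trop_rational_sum:
  assumes "\<And>x. x \<in> A \<Longrightarrow> trop_rational I (f x)"
  shows "trop_rational I (\<lambda>z. \<Sum>x\<in>A. f x z)"
  using assms
proof (induction A rule: infinite_finite_induct)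
  case (insert x A)
  then have "trop_rational I (\<lambda>z. f x z + (\<Sum>x\<in>A. f x z))"
    by (intro trop_rational_add) auto
  then show ?case using insert.hyps by simp
qed (simp_all add: trop_rational_const)

lemma trop_rational_scale:
  assumes "trop_rational I f"
  shows "trop_rational I (\<lambda>z. real m * f z)"
  using trop_rational_sum[of "{..<m}" I "\<lambda>_. f"] assms by simp

lemma trop_rational_Max:
  assumes "finite A" "A \<noteq> {}" "\<And>x. x \<in> A \<Longrightarrow> trop_rational I (f x)"
  shows "trop_rational I (\<lambda>z. Max ((\<lambda>x. f x z) ` A))"
  using assms
proof (induction A rule: finite_ne_induct)
  case (insert x A)
  have "trop_rational I (\<lambda>z. max (f x z) (Max ((\<lambda>x. f x z) ` A)))"
    using insert by (intro trop_rational_max) auto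
  then show ?case using insert by simp
qed simp

lemma trop_polynomial_compose:
  assumes "trop_polynomial I f" "\<And>i. i \<in> I \<Longrightarrow> trop_rational J (\<lambda>w. l w i)"
  shows "trop_rational J (\<lambda>w. f (l w))"
proof -
  obtain T where T: "finite T" "T \<noteq> {}"
    "\<And>z. f z = Max ((\<lambda>(c, a). c + (\<Sum>i\<in>I. real (a i) * z i)) ` T)"
    using assms(1) unfolding trop_polynomial_def trop_repr_def by blast
  have "trop_rational J (\<lambda>w. Max ((\<lambda>t. fst t + (\<Sum>i\<in>I. real (snd t i) * l w i)) ` T))"
  proof (rule trop_rational_Max[OF T(1,2)])
    fix t assume "t \<in> T"
    have "trop_rational J (\<lambda>w. \<Sum>i\<in>I. real (snd t i) * l w i)"
      by (rule trop_rational_sum, rule trop_rational_scale, rule assms(2))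
    then show "trop_rational J (\<lambda>w. fst t + (\<Sum>i\<in>I. real (snd t i) * l w i))"
      by (rule trop_rational_add[OF trop_rational_const])
  qed
  then show ?thesis by (simp add: T(3) case_prod_beta)
qed

lemma trop_rational_compose:
  assumes "trop_rational I f" "\<And>i. i \<in> I \<Longrightarrow> trop_rational J (\<lambda>w. l w i)"
  shows "trop_rational J (\<lambda>w. f (l w))"
proof -
  obtain p q where "trop_polynomial I p" "trop_polynomial I q" and f: "f = (\<lambda>z. p z - q z)"
    using assms(1) unfolding trop_rational_def by blast
  then have "trop_rational J (\<lambda>w. p (l w) - q (l w))"
    using trop_polynomial_compose[where l = l and J = J, OF _ assms(2)] trop_rational_diff by blast
  then show ?thesis by (simp add: f)
qed

lemma trop_polynomial_lipschitz:
  assumes "trop_polynomial I f"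
  obtains K where "K \<ge> 0"
    "\<And>z w d. (\<And>i. i \<in> I \<Longrightarrow> \<bar>z i - w i\<bar> \<le> d) \<Longrightarrow> d \<ge> 0 \<Longrightarrow> \<bar>f z - f w\<bar> \<le> K * d"
proof -
  obtain T where T: "trop_repr I T f" using assms by (auto simp: trop_polynomial_def)
  then have "finite T" by (simp add: trop_repr_def)
  define K where "K = (\<Sum>(c, a)\<in>T. \<Sum>i\<in>I. real (a i))"
  have le: "f z \<le> f w + K * d" if zw: "\<And>i. i \<in> I \<Longrightarrow> \<bar>z i - w i\<bar> \<le> d" and "d \<ge> 0" for z w d
  proof -
    obtain c a where ca: "(c, a) \<in> T" "f z = c + (\<Sum>i\<in>I. real (a i) * z i)"
      using T unfolding trop_repr_iff by fast
    have "(\<Sum>i\<in>I. real (a i) * z i) \<le> (\<Sum>i\<in>I. real (a i) * (w i + d))"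
      using zw by (intro sum_mono mult_left_mono) (auto simp: abs_le_iff algebra_simps)
    also have "\<dots> = (\<Sum>i\<in>I. real (a i) * w i) + (\<Sum>i\<in>I. real (a i)) * d"
      by (simp add: distrib_left sum.distrib sum_distrib_right)
    finally have "f z \<le> (c + (\<Sum>i\<in>I. real (a i) * w i)) + (\<Sum>i\<in>I. real (a i)) * d"
      using ca(2) by linarith
    also have "c + (\<Sum>i\<in>I. real (a i) * w i) \<le> f w"
      using T ca(1) unfolding trop_repr_iff by fast
    also have "(\<Sum>i\<in>I. real (a i)) * d \<le> K * d"
    proof (rule mult_right_mono[OF _ \<open>d \<ge> 0\<close>])
      show "(\<Sum>i\<in>I. real (a i)) \<le> K"
        unfolding K_def
        using member_le_sum[OF ca(1), of "\<lambda>(c, a). \<Sum>i\<in>I. real (a i)"] \<open>finite T\<close>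
        by (simp add: case_prod_beta sum_nonneg)
    qed
    finally show ?thesis by simp
  qed
  show thesis
  proof (rule that)
    show "K \<ge> 0" unfolding K_def by (auto intro!: sum_nonneg)
    fix z w :: "'a \<Rightarrow> real" and d
    assume "\<And>i. i \<in> I \<Longrightarrow> \<bar>z i - w i\<bar> \<le> d" "d \<ge> 0"
    then have "f z \<le> f w + K * d" "f w \<le> f z + K * d"
      using le[of z w d] le[of w z d] by (simp_all add: abs_minus_commute)
    then show "\<bar>f z - f w\<bar> \<le> K * d" by linarith
  qed
qed

lemma trop_rational_lipschitz:
  assumes "trop_rational I f"
  obtains K where "K \<ge> 0"
    "\<And>z w d. (\<And>i. i \<in> I \<Longrightarrow> \<bar>z i - w i\<bar> \<le> d) \<Longrightarrow> d \<ge> 0 \<Longrightarrow> \<bar>f z - f w\<bar> \<le> K * d"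
proof -
  obtain p q where pq: "trop_polynomial I p" "trop_polynomial I q" and f: "f = (\<lambda>z. p z - q z)"
    using assms unfolding trop_rational_def by blast
  obtain K L where "K \<ge> 0" "L \<ge> 0"
    and K: "\<And>z w d. (\<And>i. i \<in> I \<Longrightarrow> \<bar>z i - w i\<bar> \<le> d) \<Longrightarrow> d \<ge> 0 \<Longrightarrow> \<bar>p z - p w\<bar> \<le> K * d"
    and L: "\<And>z w d. (\<And>i. i \<in> I \<Longrightarrow> \<bar>z i - w i\<bar> \<le> d) \<Longrightarrow> d \<ge> 0 \<Longrightarrow> \<bar>q z - q w\<bar> \<le> L * d"
    using trop_polynomial_lipschitz[OF pq(1)] trop_polynomial_lipschitz[OF pq(2)] by metis
  show thesis
  proof (rule that)
    show "K + L \<ge> 0" using \<open>K \<ge> 0\<close> \<open>L \<ge> 0\<close> by simp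
    fix z w :: "'a \<Rightarrow> real" and d
    assume "\<And>i. i \<in> I \<Longrightarrow> \<bar>z i - w i\<bar> \<le> d" "d \<ge> 0"
    then have "\<bar>p z - p w\<bar> \<le> K * d" "\<bar>q z - q w\<bar> \<le> L * d"
      using K[of z w d] L[of z w d] by simp_all
    then show "\<bar>f z - f w\<bar> \<le> (K + L) * d"
      unfolding f distrib_right by linarith
  qed
qed

section \<open>Alternating sums of maxima\<close>

text \<open>
  Write each maximum as \<open>m\<close> plus the integral over \<open>s > m\<close> of the indicator that some \<open>v\<^sub>j - c [j \<in> J]\<close> exceeds
  \<open>s\<close>. The alternating sum over \<open>J\<close> then turns into a product over \<open>j\<close> of differences of indicators,
  that is, of the indicators of the intervals \<open>[v\<^sub>j - c, v\<^sub>j)\<close>. So up to sign the sum is the length of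
  the part above \<open>m\<close> of the intersection of these intervals. The lower bound \<open>m\<close> makes an induction
  on \<open>S\<close> possible, which avoids the integral: a new element \<open>x\<close> only changes \<open>m\<close>.
\<close>

lemma alternating_Max_insert:
  fixes v :: "'a \<Rightarrow> real"
  assumes "finite S" "S \<noteq> {}" "c \<ge> 0"
  shows "(\<Sum>J\<in>Pow S. (-1) ^ card J * Max (insert m ((\<lambda>j. v j - (if j \<in> J then c else 0)) ` S)))
       = - ((-1) ^ card S * max 0 (Min (v ` S) - max m (Max (v ` S) - c)))"
  using assms(1,2)
proof (induction S arbitrary: m rule: finite_ne_induct)
  case (singleton x)
  have "Pow {x} = {{}, {x}}" by auto
  then show ?case using assms(3) by (auto simp: max_def)
next
  case (insert x S)
  let ?F = "\<lambda>m S J. (-1) ^ card J * Max (insert m ((\<lambda>j. v j - (if j \<in> J then c else 0)) ` S))"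
  have inj: "inj_on (insert x) (Pow S)" using insert.hyps by (auto simp: inj_on_def)
  have out: "?F m (insert x S) J = ?F (max m (v x)) S J"
    and ins: "?F m (insert x S) (insert x J) = - ?F (max m (v x - c)) S J" if "J \<in> Pow S" for J
  proof -
    have J: "finite J" "x \<notin> J" using that insert.hyps finite_subset by auto
    have eq: "(\<lambda>j. v j - (if j \<in> insert x J then c else 0)) ` S
        = (\<lambda>j. v j - (if j \<in> J then c else 0)) ` S"
      using insert.hyps by (intro image_cong) auto
    show "?F m (insert x S) J = ?F (max m (v x)) S J"
      using J insert.hyps by (simp add: max.assoc max.left_commute)
    show "?F m (insert x S) (insert x J) = - ?F (max m (v x - c)) S J"
      unfolding image_insert eq using J insert.hyps by (simp add: max.assoc max.left_commute)
  qed
  have "(\<Sum>J\<in>Pow (insert x S). ?F m (insert x S) J)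
      = (\<Sum>J\<in>Pow S. ?F m (insert x S) J) + (\<Sum>J\<in>insert x ` Pow S. ?F m (insert x S) J)"
    unfolding Pow_insert using insert.hyps by (intro sum.union_disjoint) auto
  also have "\<dots> = (\<Sum>J\<in>Pow S. ?F (max m (v x)) S J) - (\<Sum>J\<in>Pow S. ?F (max m (v x - c)) S J)"
    unfolding sum.reindex[OF inj] comp_def using out ins by (simp add: sum_negf)
  also have "\<dots> = - ((-1) ^ card (insert x S) *
      max 0 (Min (v ` insert x S) - max m (Max (v ` insert x S) - c)))"
  proof -
    define a b where "a = Min (v ` S)" and "b = Max (v ` S)"
    (* The interval from max m (max (v x - c) (b - c)) to a is cut at the point v x. *)
    have *: "max 0 (a - max (max m (v x - c)) (b - c)) - max 0 (a - max (max m (v x)) (b - c))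
        = max 0 (min (v x) a - max m (max (v x) b - c))"
      using \<open>c \<ge> 0\<close> by linarith
    have mm: "Min (v ` insert x S) = min (v x) a" "Max (v ` insert x S) = max (v x) b"
      using insert.hyps by (auto simp: a_def b_def)
    show ?thesis
      unfolding insert.IH mm a_def[symmetric] b_def[symmetric] *[symmetric] using insert.hyps(1,3)
      by (simp add: algebra_simps)
  qed
  finally show ?case .
qed

text \<open>The lower bound has no effect once it lies below all the shifted values.\<close>

lemma alternating_Max:
  fixes v :: "'a \<Rightarrow> real"
  assumes "finite S" "S \<noteq> {}" "c \<ge> 0"
  shows "(\<Sum>J\<in>Pow S. (-1) ^ card J * Max ((\<lambda>j. v j - (if j \<in> J then c else 0)) ` S))
       = - ((-1) ^ card S * max 0 (c - (Max (v ` S) - Min (v ` S))))"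
proof -
  define m where "m = Min (v ` S) - c"
  have "m \<le> Max ((\<lambda>j. v j - (if j \<in> J then c else 0)) ` S)" for J
  proof -
    obtain j where "j \<in> S" using assms(2) by auto
    then have "Min (v ` S) \<le> v j" using assms(1) by simp
    then have "m \<le> v j - (if j \<in> J then c else 0)"
      unfolding m_def using assms(3) by auto
    also have "\<dots> \<le> Max ((\<lambda>j. v j - (if j \<in> J then c else 0)) ` S)"
      using \<open>j \<in> S\<close> assms(1) by (intro Max_ge) auto
    finally show ?thesis .
  qed
  then have "Max ((\<lambda>j. v j - (if j \<in> J then c else 0)) ` S)
      = Max (insert m ((\<lambda>j. v j - (if j \<in> J then c else 0)) ` S))" for J
    using assms by (simp add: max_absorb2)
  moreover have "max m (Max (v ` S) - c) = Max (v ` S) - c"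
    unfolding m_def using assms(1,2) by (intro max_absorb2) (simp add: Min_le_iff)
  ultimately show ?thesis using alternating_Max_insert[OF assms, of m v]
    by (simp add: algebra_simps)
qed


section \<open>Matching the rows of two matrices\<close>

text \<open>The tropical (Hilbert) seminorm, which vanishes exactly on the constant vectors.\<close>

definition osc :: "'c set \<Rightarrow> ('c \<Rightarrow> real) \<Rightarrow> real" where
  "osc S v = Max (v ` S) - Min (v ` S)"

text \<open>
  The tropical product over the rows of the linear forms with the entries of the row as coefficients,
  as a function of the variables \<open>t\<close>.
\<close>

definition row_energy :: "'c set \<Rightarrow> 'a set \<Rightarrow> ('a \<Rightarrow> 'c \<Rightarrow> real) \<Rightarrow> ('c \<Rightarrow> real) \<Rightarrow> real" where
  "row_energy S I z t = (\<Sum>i\<in>I. Max ((\<lambda>j. z i j + t j) ` S))"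

lemma osc_diff_le:
  assumes "finite S" "a \<in> S" "b \<in> S"
  shows "\<bar>v a - v b\<bar> \<le> osc S v"
proof -
  have "v a \<le> Max (v ` S)" "v b \<le> Max (v ` S)" "Min (v ` S) \<le> v a" "Min (v ` S) \<le> v b"
    using assms by auto
  then show ?thesis unfolding osc_def by linarith
qed

text \<open>
  The row energy detects rows near a given vector \<open>y\<close>: on the right, a row contributes to the sum
  exactly if its distance to \<open>y\<close> is less than \<open>c\<close>, and it contributes \<open>c\<close> if it equals \<open>y\<close>.
\<close>

lemma alternating_row_energy:
  assumes "finite S" "S \<noteq> {}" "c \<ge> 0"
  shows "(\<Sum>J\<in>Pow S. (-1) ^ card J * row_energy S I z (\<lambda>j. - y j - (if j \<in> J then c else 0)))
       = - ((-1) ^ card S * (\<Sum>i\<in>I. max 0 (c - osc S (\<lambda>j. z i j - y j))))"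
proof -
  have "(\<Sum>J\<in>Pow S. (-1) ^ card J * row_energy S I z (\<lambda>j. - y j - (if j \<in> J then c else 0)))
      = (\<Sum>i\<in>I. \<Sum>J\<in>Pow S. (-1) ^ card J *
          Max ((\<lambda>j. (z i j - y j) - (if j \<in> J then c else 0)) ` S))"
    unfolding row_energy_def sum_distrib_left by (subst sum.swap) (simp add: algebra_simps)
  also have "\<dots> = (\<Sum>i\<in>I. - ((-1) ^ card S * max 0 (c - osc S (\<lambda>j. z i j - y j))))"
    unfolding alternating_Max[OF assms] osc_def ..
  finally show ?thesis by (simp add: sum_negf sum_distrib_left)
qed

text \<open>
  Let \<open>c\<close> be the distance from row \<open>i\<close> of \<open>z\<close> to the nearest row of \<open>w\<close>. Bumps of size \<open>c\<close> around this
  row sum up to at least \<open>c\<close> for \<open>z\<close>, and to \<open>0\<close> for \<open>w\<close>. Both sums are alternating sums of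
  \<open>2 ^ card S\<close> row energies, so that \<open>c \<le> 2 ^ card S * \<delta>\<close>. The common zero column \<open>s\<close> turns the
  seminorm \<open>osc\<close> into a bound on each entry.
\<close>

lemma near_row_exists:
  assumes S: "finite S" "s \<in> S" and I: "finite I" "i \<in> I" and K: "finite K" "K \<noteq> {}"
    and zero: "z i s = 0" "\<And>k. k \<in> K \<Longrightarrow> w k s = 0"
    and close: "\<And>t. \<bar>row_energy S I z t - row_energy S K w t\<bar> \<le> \<delta>"
  shows "\<exists>k\<in>K. \<forall>j\<in>S. \<bar>z i j - w k j\<bar> \<le> 2 ^ card S * \<delta>"
proof -
  let ?o = "\<lambda>k. osc S (\<lambda>j. w k j - z i j)"
  have "Min (?o ` K) \<in> ?o ` K" using K by (intro Min_in) auto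
  then obtain k where k: "k \<in> K" "\<And>k'. k' \<in> K \<Longrightarrow> ?o k \<le> ?o k'"
    using K(1) by (smt (verit) Min_le finite_imageI imageE imageI)
  define c where "c = ?o k"
  have "c \<ge> 0" using osc_diff_le[OF S(1) S(2) S(2), of "\<lambda>j. w k j - z i j"] by (simp add: c_def)
  define t where "t = (\<lambda>J j. - z i j - (if j \<in> J then c else 0))"
  define A where "A = (\<Sum>J\<in>Pow S. (-1) ^ card J * row_energy S I z (t J))"
  define B where "B = (\<Sum>J\<in>Pow S. (-1) ^ card J * row_energy S K w (t J))"
  have A: "A = - ((-1) ^ card S * (\<Sum>i'\<in>I. max 0 (c - osc S (\<lambda>j. z i' j - z i j))))"
    unfolding A_def t_def using S by (intro alternating_row_energy) (auto simp: \<open>c \<ge> 0\<close>)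
  have "B = - ((-1) ^ card S * (\<Sum>k\<in>K. max 0 (c - ?o k)))"
    unfolding B_def t_def using S by (intro alternating_row_energy) (auto simp: \<open>c \<ge> 0\<close>)
  moreover have "(\<Sum>k\<in>K. max 0 (c - ?o k)) = 0"
    using k(2) unfolding c_def by (intro sum.neutral) auto
  ultimately have "B = 0" by simp
  have "osc S (\<lambda>j. z i j - z i j) = 0"
    using S by (auto simp: osc_def image_constant_conv)
  then have "c \<le> (\<Sum>i'\<in>I. max 0 (c - osc S (\<lambda>j. z i' j - z i j)))"
    using member_le_sum[of i I "\<lambda>i'. max 0 (c - osc S (\<lambda>j. z i' j - z i j))"] I \<open>c \<ge> 0\<close> by auto
  also have "\<dots> = \<bar>A\<bar>"
    unfolding A by (simp add: abs_mult power_abs sum_nonneg)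
  also have "\<dots> = \<bar>A - B\<bar>" using \<open>B = 0\<close> by simp
  also have "A - B = (\<Sum>J\<in>Pow S. (-1) ^ card J * (row_energy S I z (t J) - row_energy S K w (t J)))"
    by (simp add: A_def B_def sum_subtractf right_diff_distrib)
  also have "\<bar>\<dots>\<bar> \<le> (\<Sum>J\<in>Pow S. \<delta>)"
    by (rule order_trans[OF sum_abs], rule sum_mono) (simp add: abs_mult power_abs close)
  also have "\<dots> = 2 ^ card S * \<delta>" using S by (simp add: card_Pow)
  finally have c: "c \<le> 2 ^ card S * \<delta>" .
  have "\<bar>z i j - w k j\<bar> \<le> 2 ^ card S * \<delta>" if "j \<in> S" for j
    using osc_diff_le[OF S(1) that S(2), of "\<lambda>j. w k j - z i j"] zero k(1) c
    by (simp add: c_def abs_minus_commute)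
  then show ?thesis using k(1) by blast
qed

lemma Max_image_attained:
  fixes f :: "'c \<Rightarrow> real"
  assumes "finite S" "S \<noteq> {}"
  shows "\<exists>j\<in>S. Max (f ` S) = f j"
  using Max_in[of "f ` S"] assms by blast

lemma Max_image_close:
  fixes u v :: "'c \<Rightarrow> real"
  assumes "finite S" "S \<noteq> {}" "\<And>j. j \<in> S \<Longrightarrow> \<bar>u j - v j\<bar> \<le> d"
  shows "\<bar>Max (u ` S) - Max (v ` S)\<bar> \<le> d"
proof -
  have "Max (u ` S) \<le> Max (v ` S) + d" if "\<And>j. j \<in> S \<Longrightarrow> \<bar>u j - v j\<bar> \<le> d" for u v
  proof -
    obtain j where j: "j \<in> S" "Max (u ` S) = u j"
      using Max_image_attained[OF assms(1,2)] by blast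
    then have "v j \<le> Max (v ` S)" using assms(1) by auto
    then show ?thesis using that[OF j(1)] j(2) by linarith
  qed
  from this[of u v] this[of v u] show ?thesis
    using assms(3) by (simp add: abs_minus_commute abs_le_iff)
qed

text \<open>
  Removing a row of \<open>z\<close> together with a nearby row of \<open>w\<close> changes the two energies by almost the same
  amount, and so enlarges their distance at most by the factor \<open>1 + 2 ^ card S\<close>.
\<close>

lemma matching_exists:
  assumes S: "finite S" "s \<in> S"
    and "finite I" "finite K" "card I = card K"
    and "\<And>i. i \<in> I \<Longrightarrow> z i s = 0" "\<And>k. k \<in> K \<Longrightarrow> w k s = 0"
    and "\<And>t. \<bar>row_energy S I z t - row_energy S K w t\<bar> \<le> \<delta>"
  shows "\<exists>\<sigma>. bij_betw \<sigma> I K \<and>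
           (\<forall>i\<in>I. \<forall>j\<in>S. \<bar>z i j - w (\<sigma> i) j\<bar> \<le> (1 + 2 ^ card S) ^ card I * \<delta>)"
  using assms(3-)
proof (induction I arbitrary: K \<delta> rule: finite_induct)
  case empty
  then show ?case by (auto simp: bij_betw_def)
next
  case (insert i I)
  let ?M = "2 ^ card S :: real"
  have "\<delta> \<ge> 0" using insert.prems(5)[of undefined] by linarith
  have "K \<noteq> {}" using insert.prems(2) insert.hyps by auto
  have "\<exists>k\<in>K. \<forall>j\<in>S. \<bar>z i j - w k j\<bar> \<le> ?M * \<delta>"
    by (rule near_row_exists[where I = "insert i I" and s = s])
      (use S insert.hyps insert.prems \<open>K \<noteq> {}\<close> in simp_all)
  then obtain k where k: "k \<in> K" "\<And>j. j \<in> S \<Longrightarrow> \<bar>z i j - w k j\<bar> \<le> ?M * \<delta>"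
    by blast
  have "\<exists>\<sigma>. bij_betw \<sigma> I (K - {k}) \<and>
      (\<forall>i\<in>I. \<forall>j\<in>S. \<bar>z i j - w (\<sigma> i) j\<bar> \<le> (1 + ?M) ^ card I * ((1 + ?M) * \<delta>))"
  proof (rule insert.IH)
    show "card I = card (K - {k})" using insert.prems(1,2) insert.hyps k(1) by simp
    fix t
    have "\<bar>Max ((\<lambda>j. z i j + t j) ` S) - Max ((\<lambda>j. w k j + t j) ` S)\<bar> \<le> ?M * \<delta>"
      using S k(2) by (intro Max_image_close) auto
    moreover have "row_energy S (insert i I) z t = Max ((\<lambda>j. z i j + t j) ` S) + row_energy S I z t"
      using insert.hyps by (simp add: row_energy_def)
    moreover have "row_energy S K w t = Max ((\<lambda>j. w k j + t j) ` S) + row_energy S (K - {k}) w t"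
      using insert.prems(1) k(1) by (simp add: row_energy_def sum.remove)
    ultimately show "\<bar>row_energy S I z t - row_energy S (K - {k}) w t\<bar> \<le> (1 + ?M) * \<delta>"
      using insert.prems(5)[of t] by (simp add: distrib_right)
  qed (use insert.prems in auto)
  then obtain \<sigma> where \<sigma>: "bij_betw \<sigma> I (K - {k})"
    "\<And>i j. i \<in> I \<Longrightarrow> j \<in> S \<Longrightarrow> \<bar>z i j - w (\<sigma> i) j\<bar> \<le> (1 + ?M) ^ card I * ((1 + ?M) * \<delta>)"
    by blast
  have "bij_betw (\<sigma>(i := k)) I (K - {k})"
    using \<sigma>(1) insert.hyps by (subst bij_betw_cong[of _ _ \<sigma>]) auto
  then have "bij_betw (\<sigma>(i := k)) (I \<union> {i}) ((K - {k}) \<union> {(\<sigma>(i := k)) i})"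
    using insert.hyps by (intro notIn_Un_bij_betw) auto
  then have "bij_betw (\<sigma>(i := k)) (insert i I) K"
    using k(1) by (simp add: insert_absorb)
  moreover have "\<bar>z i' j - w ((\<sigma>(i := k)) i') j\<bar> \<le> (1 + ?M) ^ card (insert i I) * \<delta>"
    if "i' \<in> insert i I" "j \<in> S" for i' j
  proof (cases "i' = i")
    case True
    have "?M \<le> (1 + ?M) ^ 1" by simp
    also have "\<dots> \<le> (1 + ?M) ^ card (insert i I)"
      using insert.hyps by (intro power_increasing) auto
    finally have "?M * \<delta> \<le> (1 + ?M) ^ card (insert i I) * \<delta>"
      using \<open>\<delta> \<ge> 0\<close> by (rule mult_right_mono)
    then show ?thesis using True k(2)[OF that(2)] by simp
  next
    case False
    then show ?thesis using that \<sigma>(2)[of i' j] insert.hyps by (simp add: mult_ac)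
  qed
  ultimately show ?case by blast
qed

section \<open>Elementary tropical functions\<close>

text \<open>
  Column \<open>r\<close> is a null column. With it, every row of the matrix gets exactly one column in a term of an
  elementary function, and the degree is recorded by the number of rows that do not get column \<open>r\<close>.
\<close>

definition entry :: "nat \<Rightarrow> (nat \<times> nat \<Rightarrow> real) \<Rightarrow> nat \<Rightarrow> nat \<Rightarrow> real" where
  "entry r z i j = (if j < r then z (i, j) else 0)"

text \<open>
  For \<open>size \<alpha> = n\<close> this is the tropical polarised elementary symmetric polynomial: a list \<open>b\<close> with
  multiset \<open>\<alpha>\<close> assigns column \<open>b ! i\<close> to row \<open>i\<close>.
\<close>

definition elem_trop :: "nat \<Rightarrow> nat \<Rightarrow> nat multiset \<Rightarrow> (nat \<times> nat \<Rightarrow> real) \<Rightarrow> real" where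
  "elem_trop n r \<alpha> z = Max ((\<lambda>b. \<Sum>i<n. entry r z i (b ! i)) ` permutations_of_multiset \<alpha>)"

lemma permutations_of_multiset_not_empty: "permutations_of_multiset \<alpha> \<noteq> {}"
  using ex_mset[of \<alpha>] by (auto simp: permutations_of_multiset_def)

lemma elem_trop_ge:
  "(\<Sum>i<n. entry r z i (b i)) \<le> elem_trop n r (image_mset b (mset_set {..<n})) z"
proof -
  have "mset (map b [0..<n]) = image_mset b (mset_set {..<n})"
    by (simp add: atLeast0LessThan)
  then show ?thesis unfolding elem_trop_def
    by (intro Max_ge image_eqI[of _ _ "map b [0..<n]"] finite_imageI)
      (auto simp: atLeast0LessThan intro: permutations_of_multisetI)
qed

lemma elem_trop_attained:
  assumes "size \<alpha> = n"
  obtains b where "image_mset b (mset_set {..<n}) = \<alpha>"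
    "elem_trop n r \<alpha> z = (\<Sum>i<n. entry r z i (b i))"
proof -
  have "elem_trop n r \<alpha> z \<in> (\<lambda>b. \<Sum>i<n. entry r z i (b ! i)) ` permutations_of_multiset \<alpha>"
    unfolding elem_trop_def by (intro Max_in) (auto simp: permutations_of_multiset_not_empty)
  then obtain xs where xs: "mset xs = \<alpha>" "elem_trop n r \<alpha> z = (\<Sum>i<n. entry r z i (xs ! i))"
    by (auto simp: permutations_of_multiset_def)
  have "length xs = n" using assms by (simp flip: xs(1))
  then have "mset (map (\<lambda>i. xs ! i) [0..<n]) = \<alpha>" using xs(1) map_nth[of xs] by simp
  then have "image_mset (\<lambda>i. xs ! i) (mset_set {..<n}) = \<alpha>"
    by (simp add: atLeast0LessThan)
  then show thesis using xs(2) that by blast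
qed

lemma elem_trop_repr:
  "trop_repr (mat_index n r)
     ((\<lambda>b. (0, \<lambda>(i, j). if i < n \<and> j < r \<and> j = b ! i then 1 else 0)) ` permutations_of_multiset \<alpha>)
     (elem_trop n r \<alpha>)"
proof -
  have "(\<Sum>p\<in>mat_index n r. real (case p of (i, j) \<Rightarrow> if i < n \<and> j < r \<and> j = b ! i then 1 else 0) * z p)
      = (\<Sum>i<n. entry r z i (b ! i))" for b z
  proof -
    have "(\<Sum>p\<in>mat_index n r. real (case p of (i, j) \<Rightarrow> if i < n \<and> j < r \<and> j = b ! i then 1 else 0) * z p)
      = (\<Sum>i<n. \<Sum>j<r. if j = b ! i then z (i, j) else 0)"
      unfolding mat_index_def sum.cartesian_product by (intro sum.cong) auto
    then show ?thesis by (simp add: entry_def)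
  qed
  then show ?thesis
    by (simp add: trop_repr_def permutations_of_multiset_not_empty image_image elem_trop_def)
qed

lemma elem_trop_polynomial: "trop_polynomial (mat_index n r) (elem_trop n r \<alpha>)"
  using elem_trop_repr unfolding trop_polynomial_def by blast

lemma elem_trop_degree: "trop_degree (mat_index n r) (elem_trop n r \<alpha>) \<le> n"
proof -
  let ?T = "(\<lambda>b. (0, \<lambda>(i, j). if i < n \<and> j < r \<and> j = b ! i then 1 else 0)) ` permutations_of_multiset \<alpha>
    :: (real \<times> (nat \<times> nat \<Rightarrow> nat)) set"
  have "trop_degree (mat_index n r) (elem_trop n r \<alpha>) \<le> Max ((\<lambda>(c, a). \<Sum>p\<in>mat_index n r. a p) ` ?T)"
    unfolding trop_degree_def using elem_trop_repr by (intro Least_le) blast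
  also have "\<dots> \<le> n"
  proof (rule Max.boundedI)
    fix d assume "d \<in> (\<lambda>(c, a). \<Sum>p\<in>mat_index n r. a p) ` ?T"
    then obtain b where "d = (\<Sum>p\<in>mat_index n r. case p of (i, j) \<Rightarrow> if i < n \<and> j < r \<and> j = b ! i then 1 else 0)"
      by auto
    also have "\<dots> = (\<Sum>i<n. \<Sum>j<r. if j = b ! i then 1 else 0)"
      unfolding mat_index_def sum.cartesian_product by (intro sum.cong) auto
    also have "\<dots> \<le> (\<Sum>i<n. 1)" by (intro sum_mono) simp
    finally show "d \<le> n" by simp
  qed (auto simp: permutations_of_multiset_not_empty)
  finally show ?thesis .
qed

text \<open>
  An assignment for the permuted matrix becomes one for the original matrix when it is composed with
  the inverse permutation, and it still uses the same multiset of columns.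
\<close>

lemma elem_trop_permute_rows_le:
  assumes "\<pi> permutes {..<n}" "size \<alpha> = n"
  shows "elem_trop n r \<alpha> (\<lambda>(i, j). z (\<pi> i, j)) \<le> elem_trop n r \<alpha> z"
proof -
  obtain b where b: "image_mset b (mset_set {..<n}) = \<alpha>"
    "elem_trop n r \<alpha> (\<lambda>(i, j). z (\<pi> i, j)) = (\<Sum>i<n. entry r (\<lambda>(i, j). z (\<pi> i, j)) i (b i))"
    using elem_trop_attained[OF assms(2)] by blast
  have "(\<Sum>i<n. entry r (\<lambda>(i, j). z (\<pi> i, j)) i (b i)) = (\<Sum>i<n. entry r z (\<pi> i) ((b \<circ> inv \<pi>) (\<pi> i)))"
    using assms(1) by (intro sum.cong) (simp_all add: entry_def permutes_inverses)
  also have "\<dots> = (\<Sum>i<n. entry r z i ((b \<circ> inv \<pi>) i))"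
    using sum.permute[OF assms(1), of "\<lambda>i. entry r z i ((b \<circ> inv \<pi>) i)"] by (simp add: comp_def)
  also have "\<dots> \<le> elem_trop n r (image_mset (b \<circ> inv \<pi>) (mset_set {..<n})) z"
    by (rule elem_trop_ge)
  also have "image_mset (b \<circ> inv \<pi>) (mset_set {..<n}) = image_mset b (image_mset (inv \<pi>) (mset_set {..<n}))"
    by (simp add: multiset.map_comp)
  also have "image_mset (inv \<pi>) (mset_set {..<n}) = mset_set {..<n}"
    using permutes_inv[OF assms(1)] by (simp add: image_mset_mset_set permutes_inj_on permutes_image)
  finally show ?thesis using b by simp
qed

lemma elem_trop_row_invariant:
  assumes "size \<alpha> = n"
  shows "row_invariant n (elem_trop n r \<alpha>)"
  unfolding row_invariant_def
proof (intro allI impI antisym)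
  fix \<pi> z assume \<pi>: "\<pi> permutes {..<n}"
  show "elem_trop n r \<alpha> (\<lambda>(i, j). z (\<pi> i, j)) \<le> elem_trop n r \<alpha> z"
    using elem_trop_permute_rows_le[OF \<pi> assms] .
  show "elem_trop n r \<alpha> z \<le> elem_trop n r \<alpha> (\<lambda>(i, j). z (\<pi> i, j))"
    using elem_trop_permute_rows_le[OF permutes_inv[OF \<pi>] assms, of r "\<lambda>(i, j). z (\<pi> i, j)"]
    by (simp add: permutes_inverses[OF \<pi>])
qed

lemma elem_trop_on_column:
  assumes "size \<alpha> = n" "j < r"
  shows "elem_trop n r \<alpha> (\<lambda>(_, j'). if j' = j then 1 else 0) = real (count \<alpha> j)"
proof -
  let ?z = "\<lambda>(_ :: nat, j'). if j' = j then 1 else 0 :: real"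
  obtain b where b: "image_mset b (mset_set {..<n}) = \<alpha>"
    "elem_trop n r \<alpha> ?z = (\<Sum>i<n. entry r ?z i (b i))"
    using elem_trop_attained[OF assms(1)] by blast
  have "(\<Sum>i<n. entry r ?z i (b i)) = (\<Sum>i<n. if b i = j then 1 else 0)"
    using assms(2) by (intro sum.cong) (auto simp: entry_def)
  also have "\<dots> = real (card {i \<in> {..<n}. b i = j})"
    by (simp add: sum.If_cases Int_def)
  also have "card {i \<in> {..<n}. b i = j} = count \<alpha> j"
    unfolding b(1)[symmetric] by (simp add: count_image_mset vimage_def Int_def conj_commute)
  finally show ?thesis using b(2) by simp
qed

text \<open>
  Evaluating at indicators of single columns recovers the multiplicities of the columns \<open>j < r\<close>, and
  the common size \<open>n\<close> then fixes the multiplicity of the null column.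
\<close>

lemma elem_trop_inj:
  "inj_on (elem_trop n r) (multisets_of_size {..r} n)"
proof (rule inj_onI)
  fix \<alpha> \<beta> assume ab: "\<alpha> \<in> multisets_of_size {..r} n" "\<beta> \<in> multisets_of_size {..r} n"
    and eq: "elem_trop n r \<alpha> = elem_trop n r \<beta>"
  have sz: "size \<gamma> = (\<Sum>j\<le>r. count \<gamma> j)" if "\<gamma> \<in> multisets_of_size {..r} n" for \<gamma>
    using that unfolding size_multiset_overloaded_eq multisets_of_size_def
    by (intro sum.mono_neutral_left) (auto simp: count_eq_zero_iff)
  have lt: "count \<alpha> j = count \<beta> j" if "j < r" for j
    using elem_trop_on_column[of \<alpha> n j r] elem_trop_on_column[of \<beta> n j r] ab eq that
    by (simp add: multisets_of_size_def)
  have "(\<Sum>j<r. count \<alpha> j) + count \<alpha> r = (\<Sum>j<r. count \<beta> j) + count \<beta> r"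
    using sz[OF ab(1)] sz[OF ab(2)] ab
    by (simp add: multisets_of_size_def lessThan_Suc_atMost[symmetric])
  then have "count \<alpha> r = count \<beta> r" using lt by simp
  moreover have "count \<alpha> j = 0" "count \<beta> j = 0" if "j > r" for j
    using ab that by (auto simp: multisets_of_size_def count_eq_zero_iff)
  ultimately show "\<alpha> = \<beta>"
    using lt by (intro multiset_eqI) (metis linorder_neqE_nat)
qed

text \<open>
  Expanding the tropical product of the linear forms gives
  \<open>row_energy (entry r z) t = max\<^sub>\<alpha> (e\<^sub>\<alpha>(z) + \<Sum>j\<in>\<alpha>. t j)\<close>, and such a maximum changes by no more
  than its coefficients do.
\<close>

lemma row_energy_close:
  assumes "\<And>\<alpha>. \<alpha> \<in> multisets_of_size {..r} n \<Longrightarrow> \<bar>elem_trop n r \<alpha> z - elem_trop n r \<alpha> w\<bar> \<le> \<delta>"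
  shows "\<bar>row_energy {..r} {..<n} (entry r z) t - row_energy {..r} {..<n} (entry r w) t\<bar> \<le> \<delta>"
proof -
  have le: "row_energy {..r} {..<n} (entry r z) t \<le> row_energy {..r} {..<n} (entry r w) t + \<delta>"
    if le: "\<And>\<alpha>. \<alpha> \<in> multisets_of_size {..r} n \<Longrightarrow> elem_trop n r \<alpha> z \<le> elem_trop n r \<alpha> w + \<delta>" for z w
  proof -
    have "\<exists>j\<in>{..r}. Max ((\<lambda>j. entry r z i j + t j) ` {..r}) = entry r z i j + t j" for i
      by (rule Max_image_attained) auto
    then obtain b where b: "\<And>i. b i \<in> {..r}"
      "\<And>i. Max ((\<lambda>j. entry r z i j + t j) ` {..r}) = entry r z i (b i) + t (b i)"
      by metis
    define \<alpha> where "\<alpha> = image_mset b (mset_set {..<n})"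
    have \<alpha>: "\<alpha> \<in> multisets_of_size {..r} n"
      using b(1) by (auto simp: \<alpha>_def multisets_of_size_def)
    then obtain b' where b': "image_mset b' (mset_set {..<n}) = \<alpha>"
      "elem_trop n r \<alpha> w = (\<Sum>i<n. entry r w i (b' i))"
      using elem_trop_attained[of \<alpha> n r w] by (auto simp: multisets_of_size_def)
    have in_range: "b' i \<in> {..r}" if "i < n" for i
    proof -
      have "b' i \<in> set_mset \<alpha>" unfolding b'(1)[symmetric] using that by simp
      then show ?thesis using \<alpha> by (auto simp: multisets_of_size_def)
    qed
    have t_sum: "(\<Sum>i<n. t (c i)) = sum_mset (image_mset t \<alpha>)"
      if "image_mset c (mset_set {..<n}) = \<alpha>" for c
      unfolding that[symmetric] by (simp add: sum_unfold_sum_mset multiset.map_comp comp_def)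
    have "row_energy {..r} {..<n} (entry r z) t = (\<Sum>i<n. entry r z i (b i)) + (\<Sum>i<n. t (b i))"
      unfolding row_energy_def b(2) by (simp add: sum.distrib)
    also have "\<dots> \<le> elem_trop n r \<alpha> z + (\<Sum>i<n. t (b i))"
      using elem_trop_ge[where b = b] by (simp add: \<alpha>_def)
    also have "(\<Sum>i<n. t (b i)) = (\<Sum>i<n. t (b' i))"
      using t_sum[of b] t_sum[OF b'(1)] by (simp add: \<alpha>_def)
    also have "elem_trop n r \<alpha> z \<le> (\<Sum>i<n. entry r w i (b' i)) + \<delta>"
      using le[OF \<alpha>] b'(2) by simp
    also have "(\<Sum>i<n. entry r w i (b' i)) + \<delta> + (\<Sum>i<n. t (b' i))
        = (\<Sum>i<n. entry r w i (b' i) + t (b' i)) + \<delta>"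
      by (simp add: sum.distrib)
    also have "(\<Sum>i<n. entry r w i (b' i) + t (b' i)) \<le> row_energy {..r} {..<n} (entry r w) t"
      unfolding row_energy_def using in_range by (intro sum_mono Max_ge) auto
    finally show ?thesis by simp
  qed
  have "row_energy {..r} {..<n} (entry r z) t \<le> row_energy {..r} {..<n} (entry r w) t + \<delta>"
    using assms by (intro le) (smt (verit))
  moreover have "row_energy {..r} {..<n} (entry r w) t \<le> row_energy {..r} {..<n} (entry r z) t + \<delta>"
    using assms by (intro le) (smt (verit))
  ultimately show ?thesis by linarith
qed

text \<open>
  Let \<open>a k\<close> be a column that maximises \<open>z\<^sub>k - z\<^sub>i\<close>, and \<open>\<beta>\<close> the multiset of the \<open>a k\<close> with \<open>k \<noteq> i\<close>.
  Subtracting \<open>z\<^sub>i\<close> from every row changes the terms of \<open>e\<^sub>\<alpha>\<close> all by the same amount, as each column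
  is used as often as it occurs in \<open>\<alpha>\<close>. After the subtraction row \<open>i\<close> vanishes, so that for
  \<open>\<alpha> = add_mset j \<beta>\<close> it is optimal to give \<open>j\<close> to row \<open>i\<close> and \<open>a k\<close> to every other row \<open>k\<close>: each
  row then attains its own maximum. Hence \<open>e\<^sub>\<alpha>(z) = z\<^sub>i\<^sub>j + C\<close> with \<open>C\<close> independent of \<open>j\<close>.
\<close>

lemma entry_from_elem_trop:
  assumes "i < n"
  obtains \<beta> where "\<beta> \<in> multisets_of_size {..r} (n - 1)"
    "\<And>j. j \<le> r \<Longrightarrow>
       entry r z i j = elem_trop n r (add_mset j \<beta>) z - elem_trop n r (add_mset r \<beta>) z"
proof -
  define I where "I = {..<n} - {i}"
  have I: "{..<n} = insert i I" "i \<notin> I" "finite I" using assms by (auto simp: I_def)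
  have "\<exists>l\<in>{..r}. \<forall>j\<in>{..r}. entry r z k j - entry r z i j \<le> entry r z k l - entry r z i l" for k
  proof -
    let ?f = "\<lambda>j. entry r z k j - entry r z i j"
    have "\<exists>l\<in>{..r}. Max (?f ` {..r}) = ?f l" by (rule Max_image_attained) auto
    then obtain l where l: "l \<in> {..r}" "Max (?f ` {..r}) = ?f l" by blast
    have "?f j \<le> Max (?f ` {..r})" if "j \<in> {..r}" for j using that by (intro Max_ge) auto
    then show ?thesis using l by auto
  qed
  then obtain a where a: "\<And>k. a k \<in> {..r}"
    "\<And>k j. j \<le> r \<Longrightarrow> entry r z k j - entry r z i j \<le> entry r z k (a k) - entry r z i (a k)"
    by (metis atMost_iff)
  define \<beta> where "\<beta> = image_mset a (mset_set I)"
  define C where "C = (\<Sum>k\<in>I. entry r z k (a k))"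
  have card: "card I = n - 1" using assms by (simp add: I_def)
  have \<beta>: "\<beta> \<in> multisets_of_size {..r} (n - 1)"
    using a(1) card by (auto simp: \<beta>_def multisets_of_size_def)
  have eq: "elem_trop n r (add_mset j \<beta>) z = entry r z i j + C" if "j \<le> r" for j
  proof (rule antisym)
    let ?b = "a(i := j)"
    have "image_mset ?b (mset_set {..<n}) = add_mset j \<beta>"
      unfolding I(1) \<beta>_def using I(2,3) by (auto intro!: image_mset_cong)
    moreover have "(\<Sum>k<n. entry r z k (?b k)) = entry r z i j + C"
      unfolding I(1) C_def using I(2,3) by (auto intro!: sum.cong)
    ultimately show "entry r z i j + C \<le> elem_trop n r (add_mset j \<beta>) z"
      using elem_trop_ge[of r z ?b n] by simp
  next
    have "size (add_mset j \<beta>) = n" using card assms by (simp add: \<beta>_def)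
    then obtain b where b: "image_mset b (mset_set {..<n}) = add_mset j \<beta>"
      "elem_trop n r (add_mset j \<beta>) z = (\<Sum>k<n. entry r z k (b k))"
      by (rule elem_trop_attained)
    have in_range: "b k \<le> r" if "k < n" for k
    proof -
      have "b k \<in> set_mset (add_mset j \<beta>)" unfolding b(1)[symmetric] using that by simp
      then show ?thesis using \<beta> \<open>j \<le> r\<close> by (auto simp: multisets_of_size_def)
    qed
    have "(\<Sum>k<n. entry r z k (b k))
        = (\<Sum>k<n. entry r z k (b k) - entry r z i (b k)) + (\<Sum>k<n. entry r z i (b k))"
      by (simp add: sum_subtractf)
    also have "(\<Sum>k<n. entry r z i (b k)) = sum_mset (image_mset (entry r z i) (add_mset j \<beta>))"
      unfolding b(1)[symmetric] by (simp add: sum_unfold_sum_mset multiset.map_comp comp_def)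
    also have "\<dots> = entry r z i j + (\<Sum>k\<in>I. entry r z i (a k))"
      by (simp add: \<beta>_def sum_unfold_sum_mset multiset.map_comp comp_def)
    also have "(\<Sum>k<n. entry r z k (b k) - entry r z i (b k))
        = (\<Sum>k\<in>I. entry r z k (b k) - entry r z i (b k))"
      unfolding I(1) using I(2,3) by simp
    also have "\<dots> \<le> (\<Sum>k\<in>I. entry r z k (a k) - entry r z i (a k))"
      using a(2) in_range by (intro sum_mono) (auto simp: I_def)
    also have "\<dots> + (entry r z i j + (\<Sum>k\<in>I. entry r z i (a k))) = entry r z i j + C"
      by (simp add: C_def sum_subtractf)
    finally show "elem_trop n r (add_mset j \<beta>) z \<le> entry r z i j + C" using b(2) by simp
  qed
  show thesis
  proof (rule that[OF \<beta>])
    fix j assume "j \<le> r"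
    then show "entry r z i j = elem_trop n r (add_mset j \<beta>) z - elem_trop n r (add_mset r \<beta>) z"
      using eq[of j] eq[of r] by (simp add: entry_def)
  qed
qed

text \<open>
  Invariance allows to permute the rows of \<open>w\<close> so that they match those of \<open>z\<close>; then \<open>f\<close> is compared
  at two nearby matrices, and tropical rational functions are Lipschitz. The constant is a natural
  number because it becomes an exponent in a tropical expression.
\<close>

lemma invariant_lipschitz:
  assumes "f \<in> inv_trop_rational n r"
  obtains N :: nat where
    "\<And>z w. \<bar>f z - f w\<bar> \<le> N * (\<Sum>\<alpha>\<in>multisets_of_size {..r} n. \<bar>elem_trop n r \<alpha> z - elem_trop n r \<alpha> w\<bar>)"
proof -
  have rat: "trop_rational (mat_index n r) f" and inv: "row_invariant n f"
    using assms by (auto simp: inv_trop_rational_def)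
  obtain K where K: "K \<ge> 0" "\<And>z w d. (\<And>p. p \<in> mat_index n r \<Longrightarrow> \<bar>z p - w p\<bar> \<le> d) \<Longrightarrow> d \<ge> 0 \<Longrightarrow>
      \<bar>f z - f w\<bar> \<le> K * d"
    using trop_rational_lipschitz[OF rat] by metis
  define M :: real where "M = (1 + 2 ^ card {..r}) ^ n"
  obtain N :: nat where N: "K * M \<le> N" using real_arch_simple by blast
  show thesis
  proof (rule that)
    fix z w
    define \<delta> where "\<delta> = (\<Sum>\<alpha>\<in>multisets_of_size {..r} n. \<bar>elem_trop n r \<alpha> z - elem_trop n r \<alpha> w\<bar>)"
    have "\<delta> \<ge> 0" by (auto simp: \<delta>_def intro: sum_nonneg)
    have fin: "finite (multisets_of_size {..r} n)" by (simp add: finite_multisets_of_size)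
    have "\<bar>elem_trop n r \<alpha> z - elem_trop n r \<alpha> w\<bar> \<le> \<delta>" if "\<alpha> \<in> multisets_of_size {..r} n" for \<alpha>
      unfolding \<delta>_def using fin that
      by (intro member_le_sum[of _ _ "\<lambda>\<alpha>. \<bar>elem_trop n r \<alpha> z - elem_trop n r \<alpha> w\<bar>"]) auto
    then have "\<bar>row_energy {..r} {..<n} (entry r z) t - row_energy {..r} {..<n} (entry r w) t\<bar> \<le> \<delta>" for t
      by (rule row_energy_close)
    then have "\<exists>\<sigma>. bij_betw \<sigma> {..<n} {..<n} \<and> (\<forall>i\<in>{..<n}. \<forall>j\<in>{..r}.
        \<bar>entry r z i j - entry r w (\<sigma> i) j\<bar> \<le> (1 + 2 ^ card {..r}) ^ card {..<n} * \<delta>)"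
      by (intro matching_exists[where s = r]) (auto simp: entry_def[where j = r])
    then obtain \<sigma> where \<sigma>: "bij_betw \<sigma> {..<n} {..<n}"
      "\<And>i j. i < n \<Longrightarrow> j \<le> r \<Longrightarrow> \<bar>entry r z i j - entry r w (\<sigma> i) j\<bar> \<le> M * \<delta>"
      unfolding M_def by auto
    define \<pi> where "\<pi> = (\<lambda>i. if i < n then \<sigma> i else i)"
    have "bij_betw \<pi> {..<n} {..<n}"
      using \<sigma>(1) by (subst bij_betw_cong[of _ _ \<sigma>]) (auto simp: \<pi>_def)
    then have "\<pi> permutes {..<n}" by (rule bij_imp_permutes) (simp add: \<pi>_def)
    then have "f w = f (\<lambda>(i, j). w (\<pi> i, j))" using inv by (simp add: row_invariant_def)
    moreover have "\<bar>f z - f (\<lambda>(i, j). w (\<pi> i, j))\<bar> \<le> K * (M * \<delta>)"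
    proof (rule K(2))
      fix p assume "p \<in> mat_index n r"
      then obtain i j where "p = (i, j)" "i < n" "j < r" by (auto simp: mat_index_def)
      then show "\<bar>z p - (case p of (i, j) \<Rightarrow> w (\<pi> i, j))\<bar> \<le> M * \<delta>"
        using \<sigma>(2)[of i j] by (simp add: entry_def \<pi>_def)
    qed (simp add: M_def \<open>\<delta> \<ge> 0\<close>)
    moreover have "K * (M * \<delta>) \<le> N * \<delta>"
      using mult_right_mono[OF N \<open>\<delta> \<ge> 0\<close>] by (simp add: mult.assoc)
    ultimately show "\<bar>f z - f w\<bar>
        \<le> N * (\<Sum>\<alpha>\<in>multisets_of_size {..r} n. \<bar>elem_trop n r \<alpha> z - elem_trop n r \<alpha> w\<bar>)"
      unfolding \<delta>_def[symmetric] by simp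
  qed
qed

lemma elem_trop_null: "elem_trop n r (replicate_mset n r) z = 0"
proof -
  obtain b where b: "image_mset b (mset_set {..<n}) = replicate_mset n r"
    "elem_trop n r (replicate_mset n r) z = (\<Sum>i<n. entry r z i (b i))"
    using elem_trop_attained[of "replicate_mset n r" n r z] by auto
  have "b i = r" if "i < n" for i
  proof -
    have "b i \<in> set_mset (replicate_mset n r)" unfolding b(1)[symmetric] using that by simp
    then show ?thesis by (auto split: if_splits)
  qed
  then show ?thesis using b(2) by (simp add: entry_def)
qed

theorem corollary3p6:
  fixes n r :: nat
  assumes "n \<ge> 1" and "r \<ge> 1"
  shows "\<exists>h :: nat \<Rightarrow> (nat \<times> nat \<Rightarrow> real) \<Rightarrow> real.
           inj_on h {..<((n + r) choose r) - 1} \<and>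
           (\<forall>j < ((n + r) choose r) - 1.
              trop_polynomial (mat_index n r) (h j) \<and>
              row_invariant n (h j) \<and>
              trop_degree (mat_index n r) (h j) \<le> n) \<and>
           trop_generates (((n + r) choose r) - 1) h (inv_trop_rational n r)"
proof -
  let ?e = "elem_trop n r"
  define A where "A = multisets_of_size {..r} n"
  define \<nu> where "\<nu> = replicate_mset n r"
  define k where "k = ((n + r) choose r) - 1"
  have "finite A" by (simp add: A_def finite_multisets_of_size)
  have "\<nu> \<in> A" by (auto simp: A_def \<nu>_def multisets_of_size_def split: if_splits)
  have "card A = (n + r) choose r"
    using binomial_symmetric[of n "n + r"] by (simp add: A_def card_multisets_of_size add.commute)
  then have "card (A - {\<nu>}) = k" using \<open>\<nu> \<in> A\<close> \<open>finite A\<close> by (simp add: k_def)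
  then obtain enum where enum: "bij_betw enum {..<k} (A - {\<nu>})"
    using ex_bij_betw_nat_finite[of "A - {\<nu>}"] \<open>finite A\<close> by (auto simp: atLeast0LessThan)
  define h where "h j = ?e (enum j)" for j
  have enum_in: "enum j \<in> A" if "j < k" for j
    using bij_betwE[OF enum] that by auto
  have size: "size \<alpha> = n" if "\<alpha> \<in> A" for \<alpha> using that by (simp add: A_def multisets_of_size_def)

  have "inj_on h {..<k}"
    unfolding h_def using enum elem_trop_inj[of n r]
    by (intro comp_inj_on[of enum _ ?e, unfolded comp_def])
      (auto simp: bij_betw_def A_def intro: inj_on_subset)

  moreover have "\<exists>g. trop_rational {..<k} g \<and> f = (\<lambda>z. g (\<lambda>j. h j z))"
    if f: "f \<in> inv_trop_rational n r" for f
  proof -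
    obtain N :: nat where N: "\<And>z w. \<bar>f z - f w\<bar> \<le> N * (\<Sum>\<alpha>\<in>A. \<bar>?e \<alpha> z - ?e \<alpha> w\<bar>)"
      using invariant_lipschitz[OF f] unfolding A_def by metis
    have f_rat: "trop_rational (mat_index n r) f" using f by (simp add: inv_trop_rational_def)
    (* The coordinate of the generator belonging to the multiset; the omitted multiset has e = 0. *)
    define val where "val w \<alpha> = (if \<alpha> = \<nu> then 0 else w (inv_into {..<k} enum \<alpha>))"
      for w :: "nat \<Rightarrow> real" and \<alpha>
    have val_e: "val (\<lambda>j. h j z) \<alpha> = ?e \<alpha> z" if "\<alpha> \<in> A" for \<alpha> z
      using that enum bij_betw_inv_into_right[OF enum, of \<alpha>]
      by (auto simp: val_def h_def \<nu>_def elem_trop_null)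
    have val_rat: "trop_rational {..<k} (\<lambda>w. val w \<alpha>)" if "\<alpha> \<in> A" for \<alpha>
    proof (cases "\<alpha> = \<nu>")
      case False
      then have "inv_into {..<k} enum \<alpha> \<in> {..<k}"
        using that enum by (intro inv_into_into) (auto simp: bij_betw_def)
      then show ?thesis using False
        by (simp add: val_def trop_rational_of_polynomial trop_polynomial_coordinate)
    qed (simp add: val_def trop_rational_const)
    (* The candidate inverse belonging to a choice of one multiset per row. *)
    define L where "L \<tau> w = (\<lambda>(i, j). val w (add_mset j (\<tau> i)) - val w (add_mset r (\<tau> i)))"
      for \<tau> :: "nat \<Rightarrow> nat multiset" and w
    define X where "X = PiE {..<n} (\<lambda>_. multisets_of_size {..r} (n - 1))"
    have "finite X" by (auto simp: X_def intro: finite_PiE finite_multisets_of_size)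
    have add_in: "add_mset j (\<tau> i) \<in> A" if "\<tau> \<in> X" "i < n" "j \<le> r" for \<tau> i j
      using that assms(1) by (force simp: X_def A_def multisets_of_size_def PiE_iff)
    have L_rat: "trop_rational {..<k} (\<lambda>w. L \<tau> w p)" if "\<tau> \<in> X" "p \<in> mat_index n r" for \<tau> p
    proof -
      obtain i j where p: "p = (i, j)" "i < n" "j < r" using \<open>p \<in> _\<close> by (auto simp: mat_index_def)
      have "add_mset j (\<tau> i) \<in> A" "add_mset r (\<tau> i) \<in> A" using add_in \<open>\<tau> \<in> X\<close> p(2,3) by simp_all
      then show ?thesis
        unfolding L_def p(1) prod.case by (intro trop_rational_diff val_rat)
    qed
    (* The penalty makes wrong candidates harmless; it is zero for correct ones. *)
    define G where "G w \<tau> = f (L \<tau> w) - N * (\<Sum>\<alpha>\<in>A. \<bar>?e \<alpha> (L \<tau> w) - val w \<alpha>\<bar>)" for w \<tau>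
    define g where "g w = Max (G w ` X)" for w
    have G_rat: "trop_rational {..<k} (\<lambda>w. G w \<tau>)" if "\<tau> \<in> X" for \<tau>
      unfolding G_def
    proof (rule trop_rational_diff[OF _ trop_rational_scale[OF trop_rational_sum[OF
          trop_rational_abs[OF trop_rational_diff]]]])
      show "trop_rational {..<k} (\<lambda>w. f (L \<tau> w))"
        by (rule trop_rational_compose[OF f_rat L_rat[OF that]])
      fix \<alpha> assume "\<alpha> \<in> A"
      show "trop_rational {..<k} (\<lambda>w. ?e \<alpha> (L \<tau> w))"
        by (rule trop_polynomial_compose[OF elem_trop_polynomial L_rat[OF that]])
      show "trop_rational {..<k} (\<lambda>w. val w \<alpha>)" using \<open>\<alpha> \<in> A\<close> by (rule val_rat)
    qed
    have exact: "\<exists>\<tau>\<in>X. \<forall>p\<in>mat_index n r. L \<tau> (\<lambda>j. h j z) p = z p" for z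
    proof -
      have "\<exists>\<beta>. \<beta> \<in> multisets_of_size {..r} (n - 1) \<and>
          (\<forall>j\<le>r. entry r z i j = ?e (add_mset j \<beta>) z - ?e (add_mset r \<beta>) z)" if "i < n" for i
        using entry_from_elem_trop[OF that, of r z] by metis
      then obtain \<tau> where \<tau>: "\<And>i. i < n \<Longrightarrow> \<tau> i \<in> multisets_of_size {..r} (n - 1)"
        "\<And>i j. i < n \<Longrightarrow> j \<le> r \<Longrightarrow>
           entry r z i j = ?e (add_mset j (\<tau> i)) z - ?e (add_mset r (\<tau> i)) z"
        by metis
      define \<tau>' where "\<tau>' = restrict \<tau> {..<n}"
      have "\<tau>' \<in> X" using \<tau>(1) by (auto simp: \<tau>'_def X_def)
      moreover have "L \<tau>' (\<lambda>j. h j z) (i, j) = z (i, j)" if "i < n" "j < r" for i j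
        using \<tau>(2)[of i j] that add_in[OF \<open>\<tau>' \<in> X\<close>, of i]
        by (simp add: L_def val_e \<tau>'_def entry_def)
      ultimately show ?thesis by (intro bexI[of _ \<tau>']) (auto simp: mat_index_def)
    qed
    have "g (\<lambda>j. h j z) = f z" for z
      unfolding g_def
    proof (rule Max_eqI)
      let ?w = "\<lambda>j. h j z"
      show "finite (G ?w ` X)" using \<open>finite X\<close> by simp
      fix y assume "y \<in> G ?w ` X"
      then obtain \<tau> where "y = G ?w \<tau>" by auto
      then show "y \<le> f z" using N[of "L \<tau> ?w" z] by (simp add: G_def val_e)
    next
      let ?w = "\<lambda>j. h j z"
      obtain \<tau> where "\<tau> \<in> X" and \<tau>: "\<forall>p\<in>mat_index n r. L \<tau> ?w p = z p"
        using exact[of z] by blast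
      have "f (L \<tau> ?w) = f z"
        by (rule trop_rational_cong[OF f_rat bspec[OF \<tau>]])
      moreover have "?e \<alpha> (L \<tau> ?w) = ?e \<alpha> z" for \<alpha>
        by (rule trop_polynomial_cong[OF elem_trop_polynomial bspec[OF \<tau>]])
      ultimately have "G ?w \<tau> = f z" by (simp add: G_def val_e)
      then show "f z \<in> G ?w ` X" using \<open>\<tau> \<in> X\<close> by (metis imageI)
    qed
    moreover have "trop_rational {..<k} g"
    proof -
      have "X \<noteq> {}" using exact[of undefined] by blast
      show ?thesis
        unfolding g_def by (rule trop_rational_Max[OF \<open>finite X\<close> \<open>X \<noteq> {}\<close> G_rat])
    qed
    ultimately show ?thesis by (intro exI[of _ g]) auto
  qed

  ultimately show ?thesis
    unfolding k_def[symmetric] trop_generates_def inv_trop_rational_def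
    using enum_in size
    by (intro exI[of _ h])
      (auto simp: h_def elem_trop_polynomial elem_trop_degree elem_trop_row_invariant
        trop_rational_of_polynomial)
qed

end
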